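(* For every positive integer $n$, $f(2n+1)\leq 8$; that is, for every choice of pairwise coprime integers $a_1,\dots,a_8$, every matrix $A\in M_{2n+1}(\mathbb{Z})$ can be written as $A=\sum_{i=1}^{8}a_iX_i^2$ with $X_1,\dots,X_8\in M_{2n+1}(\mathbb{Z})$.
   Context: A form $\sum_{i=1}^{m}a_iX_i^2$ with integer coefficients is called universal over $M_n(\mathbb{Z})$ if for every $A\in M_n(\mathbb{Z})$ there exist $X_1,\dots,X_m\in M_n(\mathbb{Z})$ with $A=\sum_{i=1}^{m}a_iX_i^2$. For an integer $n\geq 2$, $f(n)$ denotes the smallest positive integer $m$ such that for every choice of pairwise coprime integers $a_1,\dots,a_m$, the form $\sum_{i=1}^{m}a_iX_i^2$ is universal over $M_n(\mathbb{Z})$. *)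

theory Defs
  imports "Jordan_Normal_Form.Matrix"
begin

text \<open>Coefficients and variables of a form in \<open>m\<close> variables are families indexed by \<open>{1..m}\<close>;
  values outside this range are irrelevant. The matrices of \<open>M\<^sub>n(\<int>)\<close> are those in
  \<open>carrier_mat n n\<close>.\<close>

definition diag_quad_form :: "nat \<Rightarrow> nat \<Rightarrow> (nat \<Rightarrow> int) \<Rightarrow> (nat \<Rightarrow> int mat) \<Rightarrow> int mat" where
  "diag_quad_form n m a X =
     (\<Oplus>\<^bsub>ring_mat TYPE(int) n ()\<^esub>i\<in>{1..m}. a i \<cdot>\<^sub>m (X i ^\<^sub>m 2))"

definition universal_form :: "nat \<Rightarrow> nat \<Rightarrow> (nat \<Rightarrow> int) \<Rightarrow> bool" where
  "universal_form n m a \<longleftrightarrow>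
     (\<forall>A \<in> carrier_mat n n. \<exists>X. (\<forall>i\<in>{1..m}. X i \<in> carrier_mat n n) \<and> A = diag_quad_form n m a X)"

definition pairwise_coprime :: "nat \<Rightarrow> (nat \<Rightarrow> int) \<Rightarrow> bool" where
  "pairwise_coprime m a \<longleftrightarrow> pairwise (\<lambda>i j. coprime (a i) (a j)) {1..m}"

definition all_coprime_forms_universal :: "nat \<Rightarrow> nat \<Rightarrow> bool" where
  "all_coprime_forms_universal n m \<longleftrightarrow> (\<forall>a. pairwise_coprime m a \<longrightarrow> universal_form n m a)"

text \<open>\<^const>\<open>Least\<close> is meaningful only if some such \<open>m\<close> exists, so a bound on \<open>f_num n\<close> should be
  accompanied by a witness.\<close>

definition f_num :: "nat \<Rightarrow> nat" where
  "f_num n = (LEAST m. 1 \<le> m \<and> all_coprime_forms_universal n m)"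

end

theory Submission
  imports Defs
begin

text \<open>The matrices are split into four pairs with coprime coefficients \<open>a, b\<close>. Let \<open>X\<close> and \<open>Y\<close>
  vanish above the superdiagonal and have ones on it. Row \<open>i\<close> of \<open>X\<^sup>2\<close> is row \<open>i + 1\<close> of \<open>X\<close> plus a
  combination of earlier rows, so by Bezout the rows of \<open>X\<close> and \<open>Y\<close> can be chosen one after another
  to make \<open>a X\<^sup>2 + b Y\<^sup>2\<close> arbitrary on and below the diagonal, except in the last row; the diagonals
  of \<open>X\<close> and \<open>Y\<close> stay free and determine the entries above the diagonal. The transpose of such a
  pair, with zero diagonals, does the same strictly above the diagonal, except in the last column.
  Two pairs of idempotents supported on the last row or the last column repair these. For the
  remaining corner entry the alternating trace counts: that of \<open>X\<^sup>2\<close> is the alternating sum of the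
  squared diagonal entries of \<open>X\<close>, and \<open>x\<^sup>2 - y\<^sup>2 + z\<^sup>2\<close> represents every integer, which is why
  three rows are needed.\<close>

section \<open>Matrices as functions and squares of Hessenberg matrices\<close>

text \<open>Square matrices of size \<open>n + 1\<close> are functions on indices \<open>0, \<dots>, n\<close>.\<close>

definition sq :: "nat \<Rightarrow> (nat \<Rightarrow> nat \<Rightarrow> int) \<Rightarrow> nat \<Rightarrow> nat \<Rightarrow> int" where
  "sq n X i j = (\<Sum>k\<le>n. X i k * X k j)"

definition pair_sq ::
    "nat \<Rightarrow> int \<Rightarrow> int \<Rightarrow> (nat \<Rightarrow> nat \<Rightarrow> int) \<Rightarrow> (nat \<Rightarrow> nat \<Rightarrow> int) \<Rightarrow> nat \<Rightarrow> nat \<Rightarrow> int" where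
  "pair_sq n a b X Y i j = a * sq n X i j + b * sq n Y i j"

text \<open>Lower Hessenberg matrices with unit superdiagonal. The condition ranges over all
  indices, not only those up to \<open>n\<close>, so that rows can be fixed by induction.\<close>

definition hess :: "(nat \<Rightarrow> int) \<Rightarrow> (nat \<Rightarrow> nat \<Rightarrow> int) \<Rightarrow> bool" where
  "hess t X \<longleftrightarrow> (\<forall>i. X i i = t i \<and> X i (Suc i) = 1 \<and> (\<forall>j > Suc i. X i j = 0))"

lemma sq_transpose: "sq n (\<lambda>i j. X j i) i j = sq n X j i"
  by (simp add: sq_def mult.commute)

lemma pair_sq_transpose:
  "pair_sq n a b (\<lambda>i j. X j i) (\<lambda>i j. Y j i) i j = pair_sq n a b X Y j i"
  by (simp add: pair_sq_def sq_transpose[of n X] sq_transpose[of n Y])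

lemma hess_sq_row:
  assumes "hess t X" "i < n"
  shows "sq n X i j = (\<Sum>k\<le>Suc i. X i k * X k j)"
  unfolding sq_def
  by (rule sum.mono_neutral_right) (use assms in \<open>auto simp: hess_def\<close>)

lemma hess_sq_super1:
  assumes "hess t X" "i < n"
  shows "sq n X i (Suc i) = t i + t (Suc i)"
proof -
  have "sq n X i (Suc i) = (\<Sum>k\<in>{i, Suc i}. X i k * X k (Suc i))"
    unfolding hess_sq_row[OF assms]
    by (rule sum.mono_neutral_right) (use assms in \<open>auto simp: hess_def\<close>)
  then show ?thesis using assms by (simp add: hess_def)
qed

lemma hess_sq_super2:
  assumes "hess t X" "Suc i < n"
  shows "sq n X i (Suc (Suc i)) = 1"
proof -
  have "sq n X i (Suc (Suc i)) = (\<Sum>k\<in>{Suc i}. X i k * X k (Suc (Suc i)))"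
    unfolding hess_sq_row[OF assms(1) Suc_lessD[OF assms(2)]]
    by (rule sum.mono_neutral_right) (use assms in \<open>auto simp: hess_def\<close>)
  then show ?thesis using assms by (simp add: hess_def)
qed

lemma hess_sq_super3:
  assumes "hess t X" "Suc (Suc i) < j"
  shows "sq n X i j = 0"
  unfolding sq_def
proof (intro sum.neutral ballI)
  fix k
  show "X i k * X k j = 0"
    using assms by (cases "k \<le> Suc i") (auto simp: hess_def)
qed

lemma hess_sq_diag:
  assumes "hess t X" "i \<le> n"
  shows "sq n X i i = (t i)\<^sup>2 + (if i = 0 then 0 else X i (i - 1))
    + (if i < n then X (Suc i) i else 0)"
proof -
  have "sq n X i i = (\<Sum>k\<in>{i - 1, i, Suc i} \<inter> {..n}. X i k * X k i)"
    unfolding sq_def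
  proof (rule sum.mono_neutral_right)
    show "\<forall>k\<in>{..n} - {i - 1, i, Suc i} \<inter> {..n}. X i k * X k i = 0"
    proof
      fix k assume "k \<in> {..n} - {i - 1, i, Suc i} \<inter> {..n}"
      then have "k > Suc i \<or> i > Suc k" by auto
      then show "X i k * X k i = 0" using assms(1) by (auto simp: hess_def)
    qed
  qed auto
  \<comment> \<open>At \<open>i = 0\<close> the truncated \<open>i - 1\<close> is \<open>i\<close>
    itself, so the index set is split without counting it twice.\<close>
  moreover have "{i - 1, i, Suc i} \<inter> {..n} =
      (if i = 0 then {} else {i - 1}) \<union> {i} \<union> (if i < n then {Suc i} else {})"
    using assms(2) by auto
  moreover have "X (i - 1) i = 1" if "i > 0"
    using assms(1) that unfolding hess_def by (metis Suc_pred')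
  ultimately show ?thesis
    using assms by (auto simp: hess_def power2_eq_square)
qed

text \<open>Each subdiagonal entry occurs in two consecutive diagonal entries of the square, hence
  with opposite signs, and cancels.\<close>

lemma hess_alternating_trace:
  assumes "hess t X"
  shows "(\<Sum>i\<le>n. (- 1) ^ i * sq n X i i) = (\<Sum>i\<le>n. (- 1) ^ i * (t i)\<^sup>2)"
proof -
  \<comment> \<open>The default \<open>l 0 = 0\<close> stands for the missing left neighbour in row
    0. The last row, which has no row below it, cancels the boundary term of the telescoping
    sum.\<close>
  define l where "l i = (if i = 0 then 0 else X i (i - 1))" for i
  have telescope: "(\<Sum>i<m. (- 1) ^ i * (l i + l (Suc i))) = - ((- 1) ^ m * l m)" for m
    by (induction m) (auto simp: l_def algebra_simps)
  have "(\<Sum>i\<le>n. (- 1) ^ i * sq n X i i) =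
      (\<Sum>i\<le>n. (- 1) ^ i * (t i)\<^sup>2 + (- 1) ^ i * (l i + (if i < n then l (Suc i) else 0)))"
    by (rule sum.cong) (auto simp: hess_sq_diag[OF assms] l_def algebra_simps)
  also have "\<dots> = (\<Sum>i\<le>n. (- 1) ^ i * (t i)\<^sup>2)
      + (\<Sum>i\<le>n. (- 1) ^ i * (l i + (if i < n then l (Suc i) else 0)))"
    by (rule sum.distrib)
  also have "(\<Sum>i\<le>n. (- 1) ^ i * (l i + (if i < n then l (Suc i) else 0))) =
      (\<Sum>i<n. (- 1) ^ i * (l i + l (Suc i))) + (- 1) ^ n * l n"
    by (simp add: lessThan_Suc_atMost[symmetric])
  finally show ?thesis using telescope[of n] by simp
qed

section \<open>Prescribing rows of a combination of two squares\<close>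

lemma hess_pair_rows:
  fixes a b :: int
  assumes "coprime a b"
  shows "\<exists>X Y. hess t X \<and> hess s Y \<and> (\<forall>i < n. \<forall>j \<le> i.
    a * (\<Sum>k\<le>Suc i. X i k * X k j) + b * (\<Sum>k\<le>Suc i. Y i k * Y k j) = M i j)"
proof (induction n)
  case 0
  have "hess u (\<lambda>i j. if j = i then u i else if j = Suc i then 1 else 0)" for u
    by (auto simp: hess_def)
  then show ?case by blast
next
  case (Suc n)
  then obtain X Y where X: "hess t X" and Y: "hess s Y"
    and eq: "\<And>i j. i < n \<Longrightarrow> j \<le> i \<Longrightarrow>
      a * (\<Sum>k\<le>Suc i. X i k * X k j) + b * (\<Sum>k\<le>Suc i. Y i k * Y k j) = M i j"
    by blast
  obtain u v where uv: "u * a + v * b = 1"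
    using assms by (metis bezout_int coprime_iff_gcd_eq_1)
  \<comment> \<open>\<open>D j\<close> is what rows up to \<open>n\<close> leave of the target. Row
    \<open>Suc n\<close> enters with factor 1, so its Bezout multiples close the gap; changing only
    columns up to \<open>n\<close> keeps its diagonal entry and the 1 next to it.\<close>
  define D where
    "D j = M n j - a * (\<Sum>k\<le>n. X n k * X k j) - b * (\<Sum>k\<le>n. Y n k * Y k j)" for j
  define X' where "X' = X(Suc n := \<lambda>j. if j \<le> n then u * D j else X (Suc n) j)"
  define Y' where "Y' = Y(Suc n := \<lambda>j. if j \<le> n then v * D j else Y (Suc n) j)"
  have "hess t X'" "hess s Y'"
    using X Y by (auto simp: hess_def X'_def Y'_def)
  moreover have "a * (\<Sum>k\<le>Suc i. X' i k * X' k j) + b * (\<Sum>k\<le>Suc i. Y' i k * Y' k j) = M i j"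
    if "i < Suc n" "j \<le> i" for i j
  proof (cases "i = n")
    case True
    have "(\<Sum>k\<le>n. X' n k * X' k j) = (\<Sum>k\<le>n. X n k * X k j)"
      "(\<Sum>k\<le>n. Y' n k * Y' k j) = (\<Sum>k\<le>n. Y n k * Y k j)"
      by (auto simp: X'_def Y'_def intro: sum.cong)
    moreover have "X' n (Suc n) * X' (Suc n) j = u * D j" "Y' n (Suc n) * Y' (Suc n) j = v * D j"
      using X Y that True by (auto simp: X'_def Y'_def hess_def)
    moreover have "a * (u * D j) + b * (v * D j) = (u * a + v * b) * D j"
      by (simp add: algebra_simps)
    ultimately show ?thesis
      using True uv by (simp add: D_def distrib_left)
  next
    \<comment> \<open>Earlier equations read only rows up to \<open>n\<close>, which are
      unchanged.\<close>
    case False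
    with that have "i < n" by simp
    then have "(\<Sum>k\<le>Suc i. X' i k * X' k j) = (\<Sum>k\<le>Suc i. X i k * X k j)"
      "(\<Sum>k\<le>Suc i. Y' i k * Y' k j) = (\<Sum>k\<le>Suc i. Y i k * Y k j)"
      by (auto simp: X'_def Y'_def intro: sum.cong)
    then show ?thesis using eq[OF \<open>i < n\<close> that(2)] by simp
  qed
  ultimately show ?case by blast
qed

text \<open>The entries above the diagonal and the alternating trace depend only on \<open>t\<close>
  and \<open>s\<close>, so they are known before \<open>M\<close> is chosen.\<close>

lemma hess_pair:
  fixes a b :: int
  assumes "coprime a b"
  obtains X Y where
    "\<And>i j. j \<le> i \<Longrightarrow> i < n \<Longrightarrow> pair_sq n a b X Y i j = M i j"
    "\<And>i. i < n \<Longrightarrow> pair_sq n a b X Y i (Suc i) = a * (t i + t (Suc i)) + b * (s i + s (Suc i))"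
    "\<And>i. Suc i < n \<Longrightarrow> pair_sq n a b X Y i (Suc (Suc i)) = a + b"
    "\<And>i j. Suc (Suc i) < j \<Longrightarrow> pair_sq n a b X Y i j = 0"
    "(\<Sum>i\<le>n. (- 1) ^ i * pair_sq n a b X Y i i) =
      a * (\<Sum>i\<le>n. (- 1) ^ i * (t i)\<^sup>2) + b * (\<Sum>i\<le>n. (- 1) ^ i * (s i)\<^sup>2)"
proof -
  obtain X Y where X: "hess t X" and Y: "hess s Y"
    and eq: "\<And>i j. i < n \<Longrightarrow> j \<le> i \<Longrightarrow>
      a * (\<Sum>k\<le>Suc i. X i k * X k j) + b * (\<Sum>k\<le>Suc i. Y i k * Y k j) = M i j"
    using hess_pair_rows[OF assms, of t s n M] by blast
  have "(\<Sum>i\<le>n. (- 1) ^ i * pair_sq n a b X Y i i) =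
      a * (\<Sum>i\<le>n. (- 1) ^ i * sq n X i i) + b * (\<Sum>i\<le>n. (- 1) ^ i * sq n Y i i)"
    unfolding pair_sq_def sum_distrib_left sum.distrib[symmetric]
    by (rule sum.cong) (auto simp: distrib_left)
  note alt = this[unfolded hess_alternating_trace[OF X] hess_alternating_trace[OF Y]]
  have rows: "pair_sq n a b X Y i j = M i j" if "j \<le> i" "i < n" for i j
    using eq[OF that(2,1)] that by (simp only: pair_sq_def hess_sq_row[OF X] hess_sq_row[OF Y])
  show thesis
    by (rule that[OF rows _ _ _ alt])
      (simp_all add: pair_sq_def hess_sq_super1[OF X] hess_sq_super1[OF Y] hess_sq_super2[OF X] hess_sq_super2[OF Y]
        hess_sq_super3[OF X] hess_sq_super3[OF Y])
qed

text \<open>A matrix supported on its last row with corner entry 1 is idempotent, so squaring keeps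
  a Bezout multiple of \<open>r\<close> in that row. The price is a fixed corner.\<close>

lemma last_row_pair:
  fixes a b :: int
  assumes "coprime a b"
  obtains X Y where
    "\<And>i j. i < n \<Longrightarrow> pair_sq n a b X Y i j = 0"
    "\<And>j. j < n \<Longrightarrow> pair_sq n a b X Y n j = r j"
    "pair_sq n a b X Y n n = a + b"
proof -
  obtain u v where uv: "u * a + v * b = 1"
    using assms by (metis bezout_int coprime_iff_gcd_eq_1)
  define E where "E c i j = (if i = n then if j = n then 1 else c * r j else 0)" for c i j
  have E: "sq n (E c) i j = E c i j" for c i j
  proof -
    have "sq n (E c) i j = (\<Sum>k\<in>{n}. E c i k * E c k j)"
      unfolding sq_def by (rule sum.mono_neutral_right) (auto simp: E_def)
    then show ?thesis by (simp add: E_def)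
  qed
  have "a * (u * x) + b * (v * x) = (u * a + v * b) * x" for x
    by (simp add: algebra_simps)
  with uv have "a * (u * x) + b * (v * x) = x" for x
    by simp
  then show thesis
    by (intro that[of "E u" "E v"]) (simp_all add: pair_sq_def E, simp_all add: E_def)
qed

section \<open>Adjusting the alternating trace and assembling four pairs\<close>

lemma alternating_sum_three_squares:
  fixes c :: int
  assumes "2 \<le> n"
  obtains t :: "nat \<Rightarrow> int" where "(\<Sum>i\<le>n. (- 1) ^ i * (t i)\<^sup>2) = c"
proof -
  \<comment> \<open>The difference of the squares of \<open>k + 1\<close> and \<open>k\<close> is
    \<open>2 * k + 1\<close>; adding the square of \<open>e\<close> reaches the even numbers
    too.\<close>
  obtain k e where c: "c = 2 * k + 1 + e" and e: "e = 0 \<or> e = 1"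
    by (rule that[of "(c - 1) div 2" "(c - 1) mod 2"]) auto
  define t where "t = (\<lambda>i :: nat. 0 :: int)(0 := k + 1, 1 := k, 2 := e)"
  have "(\<Sum>i\<le>n. (- 1) ^ i * (t i)\<^sup>2) = (\<Sum>i\<in>{0, 1, 2}. (- 1) ^ i * (t i)\<^sup>2)"
    by (rule sum.mono_neutral_right) (use assms in \<open>auto simp: t_def\<close>)
  also have "\<dots> = c"
    using e unfolding c by (auto simp: t_def power2_eq_square algebra_simps)
  finally show thesis by (rule that)
qed

lemma four_pairs:
  fixes A :: "nat \<Rightarrow> nat \<Rightarrow> int"
  assumes n: "2 \<le> n"
    and cop: "coprime a1 a2" "coprime a3 a4" "coprime a5 a6" "coprime a7 a8"
  obtains X1 X2 X3 X4 X5 X6 X7 X8 where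
    "\<And>i j. i \<le> n \<Longrightarrow> j \<le> n \<Longrightarrow> A i j = pair_sq n a1 a2 X1 X2 i j + pair_sq n a3 a4 X3 X4 i j
       + pair_sq n a5 a6 X5 X6 i j + pair_sq n a7 a8 X7 X8 i j"
proof -
  \<comment> \<open>The alternating trace that the first pair must have: the second pair will have
    zero diagonal, and the two repair pairs add \<open>a5 + a6 + a7 + a8\<close> at the corner
    only.\<close>
  define V where "V = (\<Sum>i\<le>n. (- 1) ^ i * A i i) - (- 1) ^ n * (a5 + a6 + a7 + a8)"
  obtain u v where uv: "u * a1 + v * a2 = 1"
    using cop(1) by (metis bezout_int coprime_iff_gcd_eq_1)
  obtain t where t: "(\<Sum>i\<le>n. (- 1) ^ i * (t i)\<^sup>2) = u * V"
    using alternating_sum_three_squares[OF n] .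
  obtain s where s: "(\<Sum>i\<le>n. (- 1) ^ i * (s i)\<^sup>2) = v * V"
    using alternating_sum_three_squares[OF n] .
  \<comment> \<open>The first pair above the diagonal, computed from \<open>t\<close> and
    \<open>s\<close> alone. The second pair can thus be chosen before the first, whose target
    depends on it.\<close>
  define U where "U i j = (if j = Suc i then a1 * (t i + t (Suc i)) + a2 * (s i + s (Suc i))
    else if j = Suc (Suc i) then a1 + a2 else 0)" for i j
  obtain Y3 Y4 where Q:
    "\<And>i j. j \<le> i \<Longrightarrow> i < n \<Longrightarrow> pair_sq n a3 a4 Y3 Y4 i j = (if i = j then 0 else A j i - U j i)"
    "(\<Sum>i\<le>n. (- 1) ^ i * pair_sq n a3 a4 Y3 Y4 i i) =
      a3 * (\<Sum>i\<le>n. (- 1) ^ i * 0\<^sup>2) + a4 * (\<Sum>i\<le>n. (- 1) ^ i * 0\<^sup>2)"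
    by (rule hess_pair[OF cop(2), where t = "\<lambda>_. 0" and s = "\<lambda>_. 0" and n = n
          and M = "\<lambda>i j. if i = j then 0 else A j i - U j i"]) (rule that)
  let ?Q = "\<lambda>i j. pair_sq n a3 a4 Y3 Y4 j i"
  obtain X1 X2 where P:
    "\<And>i j. j \<le> i \<Longrightarrow> i < n \<Longrightarrow> pair_sq n a1 a2 X1 X2 i j = A i j - ?Q i j"
    "\<And>i. i < n \<Longrightarrow>
      pair_sq n a1 a2 X1 X2 i (Suc i) = a1 * (t i + t (Suc i)) + a2 * (s i + s (Suc i))"
    "\<And>i. Suc i < n \<Longrightarrow> pair_sq n a1 a2 X1 X2 i (Suc (Suc i)) = a1 + a2"
    "\<And>i j. Suc (Suc i) < j \<Longrightarrow> pair_sq n a1 a2 X1 X2 i j = 0"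
    "(\<Sum>i\<le>n. (- 1) ^ i * pair_sq n a1 a2 X1 X2 i i) =
      a1 * (\<Sum>i\<le>n. (- 1) ^ i * (t i)\<^sup>2) + a2 * (\<Sum>i\<le>n. (- 1) ^ i * (s i)\<^sup>2)"
    by (rule hess_pair[OF cop(1), where M = "\<lambda>i j. A i j - ?Q i j"
          and n = n and t = t and s = s]) (rule that)
  let ?P = "pair_sq n a1 a2 X1 X2"
  obtain X5 X6 where R:
    "\<And>i j. i < n \<Longrightarrow> pair_sq n a5 a6 X5 X6 i j = 0"
    "\<And>j. j < n \<Longrightarrow> pair_sq n a5 a6 X5 X6 n j = A n j - ?P n j - ?Q n j"
    "pair_sq n a5 a6 X5 X6 n n = a5 + a6"
    by (rule last_row_pair[OF cop(3), where r = "\<lambda>j. A n j - ?P n j - ?Q n j" and n = n])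
      (rule that)
  let ?R = "pair_sq n a5 a6 X5 X6"
  obtain Y7 Y8 where C:
    "\<And>i j. i < n \<Longrightarrow> pair_sq n a7 a8 Y7 Y8 i j = 0"
    "\<And>j. j < n \<Longrightarrow> pair_sq n a7 a8 Y7 Y8 n j = A j n - ?P j n - ?Q j n"
    "pair_sq n a7 a8 Y7 Y8 n n = a7 + a8"
    by (rule last_row_pair[OF cop(4), where r = "\<lambda>j. A j n - ?P j n - ?Q j n" and n = n])
      (rule that)
  let ?C = "\<lambda>i j. pair_sq n a7 a8 Y7 Y8 j i"
  have upper: "?P i j = U i j" if "i < j" "j \<le> n" for i j
    using that P(2-4) by (cases "j = Suc i"; cases "j = Suc (Suc i)") (auto simp: U_def)
  have Qd: "?Q i i = 0" if "i < n" for i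
    using Q(1)[of i i] that by simp
  \<comment> \<open>With zero \<open>t\<close> and \<open>s\<close> the alternating trace vanishes,
    which forces the one diagonal entry not prescribed to be 0.\<close>
  have Qc: "?Q n n = 0"
    using Q(2) Qd by (simp add: lessThan_Suc_atMost[symmetric])
  have "a1 * (u * V) + a2 * (v * V) = (u * a1 + v * a2) * V"
    by (simp add: algebra_simps)
  then have "(\<Sum>i\<le>n. (- 1) ^ i * ?P i i) = V"
    using P(5) t s uv by simp
  moreover have "(\<Sum>i<n. (- 1) ^ i * ?P i i) = (\<Sum>i<n. (- 1) ^ i * A i i)"
    by (rule sum.cong) (auto simp: P(1) Qd)
  \<comment> \<open>The alternating traces agree in every term before the last, so they determine
    the corner of the first pair.\<close>
  ultimately have "(- 1) ^ n * ?P n n = (- 1) ^ n * (A n n - (a5 + a6 + a7 + a8))"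
    by (simp add: V_def lessThan_Suc_atMost[symmetric] algebra_simps)
  then have corner: "A n n = ?P n n + (a5 + a6 + a7 + a8)"
    by simp
  have "A i j = ?P i j + ?Q i j + ?R i j + ?C i j" if ij: "i \<le> n" "j \<le> n" for i j
  proof -
    consider "i = n" "j = n" | "i = n" "j < n" | "i < n" "j = n"
      | "i < n" "j < n" "j \<le> i" | "i < n" "j < n" "i < j"
      using ij by linarith
    then show ?thesis
      by cases (simp_all add: corner Qc R C P(1) upper Q(1))
  qed
  then show thesis
    by (intro that[of X1 X2 "\<lambda>i j. Y3 j i" "\<lambda>i j. Y4 j i" X5 X6 "\<lambda>i j. Y7 j i" "\<lambda>i j. Y8 j i"])
      (simp add: pair_sq_transpose[of n a3 a4 Y3 Y4] pair_sq_transpose[of n a7 a8 Y7 Y8])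
qed

section \<open>From functions to library matrices\<close>

text \<open>Carrier membership is proved in the same induction because entrywise addition needs the
  dimensions of the partial sum.\<close>

lemma finsum_ring_mat:
  assumes "finite I" "\<And>i. i \<in> I \<Longrightarrow> F i \<in> carrier_mat n n"
  shows "(\<Oplus>\<^bsub>ring_mat TYPE(int) n ()\<^esub>i\<in>I. F i) \<in> carrier_mat n n \<and>
    (\<forall>r<n. \<forall>c<n. (\<Oplus>\<^bsub>ring_mat TYPE(int) n ()\<^esub>i\<in>I. F i) $$ (r, c) = (\<Sum>i\<in>I. F i $$ (r, c)))"
  using assms
proof (induction I rule: finite_induct)
  case empty
  interpret ring "ring_mat TYPE(int) n ()" by (rule ring_mat)
  have "(\<Oplus>\<^bsub>ring_mat TYPE(int) n ()\<^esub>i\<in>{}. F i) = 0\<^sub>m n n"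
    by (simp only: finsum_empty ring_mat_simps)
  then show ?case by simp
next
  case (insert x I)
  interpret ring "ring_mat TYPE(int) n ()" by (rule ring_mat)
  have "(\<Oplus>\<^bsub>ring_mat TYPE(int) n ()\<^esub>i\<in>insert x I. F i) =
      F x + (\<Oplus>\<^bsub>ring_mat TYPE(int) n ()\<^esub>i\<in>I. F i)"
    using insert.prems insert.hyps
    by (subst finsum_insert) (auto simp: ring_mat_simps)
  then show ?case
    using insert by auto
qed

lemma mat_square_index:
  assumes "i \<le> n" "j \<le> n"
  shows "(mat (Suc n) (Suc n) (\<lambda>(i, j). X i j) ^\<^sub>m 2) $$ (i, j) = sq n X i j"
  using assms
  by (simp add: numeral_2_eq_2 scalar_prod_def sq_def atLeast0LessThan lessThan_Suc_atMost)

lemma all_coprime_forms_universal_8: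
  assumes "3 \<le> N"
  shows "all_coprime_forms_universal N 8"
  unfolding all_coprime_forms_universal_def universal_form_def
proof (intro allI impI ballI)
  fix a :: "nat \<Rightarrow> int" and A :: "int mat"
  assume a: "pairwise_coprime 8 a" and A: "A \<in> carrier_mat N N"
  obtain n where n: "N = Suc n" "2 \<le> n"
    using assms by (cases N) auto
  have "coprime (a 1) (a 2)" "coprime (a 3) (a 4)" "coprime (a 5) (a 6)" "coprime (a 7) (a 8)"
    using a by (auto simp: pairwise_coprime_def pairwise_def)
  then obtain X1 X2 X3 X4 X5 X6 X7 X8 where X:
    "\<And>i j. i \<le> n \<Longrightarrow> j \<le> n \<Longrightarrow> A $$ (i, j) =
       pair_sq n (a 1) (a 2) X1 X2 i j + pair_sq n (a 3) (a 4) X3 X4 i j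
       + pair_sq n (a 5) (a 6) X5 X6 i j + pair_sq n (a 7) (a 8) X7 X8 i j"
    using four_pairs[OF n(2), where A = "\<lambda>i j. A $$ (i, j)"] by blast
  \<comment> \<open>The shift by one reconciles variables numbered from 1 with list positions
    numbered from 0.\<close>
  define F where "F k = [X1, X2, X3, X4, X5, X6, X7, X8] ! (k - 1)" for k :: nat
  define X where "X k = mat N N (\<lambda>(i, j). F k i j)" for k
  have carrier: "X k \<in> carrier_mat N N" for k
    by (simp add: X_def)
  have eight: "{1..8} = {1, 2, 3, 4, 5, 6, 7, 8 :: nat}"
    by auto
  have index: "(a k \<cdot>\<^sub>m (X k ^\<^sub>m 2)) $$ (i, j) = a k * sq n (F k) i j" if "i < N" "j < N" for k i j
    using that mat_square_index[of i n j "F k"] pow_carrier_mat[OF carrier, of k 2]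
    by (simp add: X_def n)
  note form = finsum_ring_mat[of "{1..8}" "\<lambda>k. a k \<cdot>\<^sub>m (X k ^\<^sub>m 2)" N]
  have "A = diag_quad_form N 8 a X"
  proof (rule eq_matI)
    fix i j assume "i < dim_row (diag_quad_form N 8 a X)" "j < dim_col (diag_quad_form N 8 a X)"
    then have ij: "i < N" "j < N"
      using form carrier by (auto simp: diag_quad_form_def)
    then have "diag_quad_form N 8 a X $$ (i, j) = (\<Sum>k\<in>{1..8}. a k * sq n (F k) i j)"
      using form carrier by (simp add: diag_quad_form_def index)
    also have "\<dots> = A $$ (i, j)"
      using X[of i j] ij unfolding eight by (simp add: n pair_sq_def F_def)
    finally show "A $$ (i, j) = diag_quad_form N 8 a X $$ (i, j)" ..
  qed (use A form carrier in \<open>auto simp: diag_quad_form_def\<close>)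
  with carrier show "\<exists>X. (\<forall>i\<in>{1..8}. X i \<in> carrier_mat N N) \<and> A = diag_quad_form N 8 a X"
    by (intro exI[of _ X]) simp
qed

theorem theorem3p5:
  fixes n :: nat
  assumes "n \<ge> 1"
  shows "f_num (2 * n + 1) \<le> 8 \<and>
    (\<forall>a :: nat \<Rightarrow> int. pairwise_coprime 8 a \<longrightarrow>
      (\<forall>A \<in> carrier_mat (2 * n + 1) (2 * n + 1).
        \<exists>X :: nat \<Rightarrow> int mat. (\<forall>i\<in>{1..8}. X i \<in> carrier_mat (2 * n + 1) (2 * n + 1)) \<and>
          A = diag_quad_form (2 * n + 1) 8 a X))"
proof -
  have universal: "all_coprime_forms_universal (2 * n + 1) 8"
    using assms by (intro all_coprime_forms_universal_8) simp
  then have "f_num (2 * n + 1) \<le> 8"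
    unfolding f_num_def by (intro Least_le) simp
  with universal show ?thesis
    by (simp add: all_coprime_forms_universal_def universal_form_def)
qed

end
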